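(* Let $\mathcal{A}$ be a finite alphabet and let $u = (u_n)_{n \geq 0} \in \mathcal{A}^{\mathbb{N}}$ be a fixed point of a primitive morphism $\sigma$ on $\mathcal{A}$ satisfying the following conditions: (i) $\sigma$ belongs to class P: there exist a palindrome $p$ and, for every $a \in \mathcal{A}$, a palindrome $q_a$ such that $\sigma(a) = p q_a$ for every $a \in \mathcal{A}$ (or, alternatively, $\sigma(a) = q_a p$ for every $a \in \mathcal{A}$); (ii) $\sigma$ is uniform; let $d$ be its length, i.e. $d = |\sigma(a)|$ for every $a \in \mathcal{A}$; (iii) for $a \neq b$ in $\mathcal{A}$, the words $q_a$ and $q_b$ have distinct first (and hence last) symbols. Then the palindrome complexity $(\mathrm{pal}_u(k))_{k \geq 1}$ is a $d$-automatic sequence.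
   Context: $\mathbb{N} = \{0,1,2,\ldots\}$. A morphism on $\mathcal{A}$ is a monoid homomorphism from the free monoid $\mathcal{A}^*$ of finite words to itself, determined by its values on letters; it extends to infinite sequences by concatenating the images of the letters, and $u$ is a fixed point if $\sigma(u) = u$. It is uniform (of length $d$) if the images of all letters have the same length $d$. It is primitive if there exists $k \geq 1$ such that for each letter $a$, the word $\sigma^k(a)$ contains at least one occurrence of each letter of $\mathcal{A}$. A palindrome is a word equal to its reversal. In the definition of class P, the word $p$ can be empty; if $p$ is not empty then some (or all) $q_a$ are allowed to be empty. $\mathrm{pal}_u(k)$ is the number of distinct palindromes of length $k$ that are factors (blocks of consecutive letters) of $u$. A sequence is called $d$-automatic if it is the pointwise image (image under a letter-to-letter map) of an infinite fixed point of a morphism of length $d$ on some finite alphabet $\mathcal{B}$. *)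

theory Defs
  imports Main "HOL-Library.Sublist"
begin

text \<open>
  Alphabets are finite sets of letters, finite words are lists and infinite sequences are functions
  on the natural numbers. A morphism is given by its values on letters.
\<close>

definition morphism_on :: "'a set \<Rightarrow> ('a \<Rightarrow> 'a list) \<Rightarrow> bool" where
  "morphism_on A \<sigma> \<longleftrightarrow> (\<forall>a\<in>A. \<sigma> a \<in> lists A)"

definition apply_word :: "('a \<Rightarrow> 'a list) \<Rightarrow> 'a list \<Rightarrow> 'a list" where
  "apply_word \<sigma> w = concat (map \<sigma> w)"

text \<open>
  The infinite concatenation of the images of the letters of \<open>u\<close> is the infinite sequence \<open>v\<close>.
  This is a relation because the concatenation is a finite word if \<open>\<sigma>\<close> erases almost all letters of \<open>u\<close>.
\<close>

definition seq_image :: "('a \<Rightarrow> 'a list) \<Rightarrow> (nat \<Rightarrow> 'a) \<Rightarrow> (nat \<Rightarrow> 'a) \<Rightarrow> bool" where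
  "seq_image \<sigma> u v \<longleftrightarrow> (\<forall>n. \<exists>m. prefix (map v [0..<n]) (apply_word \<sigma> (map u [0..<m])))"

lemma seq_image_unique:
  assumes "seq_image \<sigma> u v" and "seq_image \<sigma> u w"
  shows "v = w"
proof
  fix n
  obtain m where m: "prefix (map v [0..<Suc n]) (apply_word \<sigma> (map u [0..<m]))"
    using assms(1) unfolding seq_image_def by blast
  obtain k where k: "prefix (map w [0..<Suc n]) (apply_word \<sigma> (map u [0..<k]))"
    using assms(2) unfolding seq_image_def by blast
  have mono: "prefix (apply_word \<sigma> (map u [0..<i])) (apply_word \<sigma> (map u [0..<i + j]))" for i j
    unfolding apply_word_def upt_add_eq_append[OF le0, of i j] map_append concat_append
    by (rule prefixI[OF refl])
  have "prefix (map v [0..<Suc n]) (apply_word \<sigma> (map u [0..<m + k]))"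
    using prefix_order.trans[OF m mono] .
  moreover have "prefix (map w [0..<Suc n]) (apply_word \<sigma> (map u [0..<m + k]))"
    using prefix_order.trans[OF k mono[of k m]] by (simp only: add.commute)
  ultimately have "take (Suc n) (apply_word \<sigma> (map u [0..<m + k])) = map v [0..<Suc n]"
    and "take (Suc n) (apply_word \<sigma> (map u [0..<m + k])) = map w [0..<Suc n]"
    by (auto elim!: prefixE simp del: upt_Suc)
  then have "map v [0..<Suc n] = map w [0..<Suc n]" by (rule trans[OF sym])
  then show "v n = w n" by simp
qed

definition fixed_point :: "('a \<Rightarrow> 'a list) \<Rightarrow> (nat \<Rightarrow> 'a) \<Rightarrow> bool" where
  "fixed_point \<sigma> u \<longleftrightarrow> seq_image \<sigma> u u"

definition uniform_on :: "'a set \<Rightarrow> nat \<Rightarrow> ('a \<Rightarrow> 'a list) \<Rightarrow> bool" where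
  "uniform_on A d \<sigma> \<longleftrightarrow> (\<forall>a\<in>A. length (\<sigma> a) = d)"

definition primitive_on :: "'a set \<Rightarrow> ('a \<Rightarrow> 'a list) \<Rightarrow> bool" where
  "primitive_on A \<sigma> \<longleftrightarrow> (\<exists>k\<ge>1. \<forall>a\<in>A. \<forall>b\<in>A. b \<in> set ((apply_word \<sigma> ^^ k) [a]))"

definition palindrome :: "'a list \<Rightarrow> bool" where
  "palindrome w \<longleftrightarrow> rev w = w"

text \<open>
  Membership in class P, witnessed by the palindromes \<open>p\<close> and \<open>q a\<close>. The \<open>q a\<close> may be empty
  only if \<open>p\<close> is nonempty.
\<close>

definition class_P_by :: "'a set \<Rightarrow> ('a \<Rightarrow> 'a list) \<Rightarrow> 'a list \<Rightarrow> ('a \<Rightarrow> 'a list) \<Rightarrow> bool" where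
  "class_P_by A \<sigma> p q \<longleftrightarrow>
     palindrome p \<and> (\<forall>a\<in>A. palindrome (q a)) \<and> (p = [] \<longrightarrow> (\<forall>a\<in>A. q a \<noteq> [])) \<and>
     ((\<forall>a\<in>A. \<sigma> a = p @ q a) \<or> (\<forall>a\<in>A. \<sigma> a = q a @ p))"

definition factor :: "'a list \<Rightarrow> (nat \<Rightarrow> 'a) \<Rightarrow> bool" where
  "factor w u \<longleftrightarrow> (\<exists>i. w = map u [i..<i + length w])"

definition pal_complexity :: "(nat \<Rightarrow> 'a) \<Rightarrow> nat \<Rightarrow> nat" where
  "pal_complexity u k = card {w. length w = k \<and> palindrome w \<and> factor w u}"

text \<open>
  Every finite alphabet can be renamed to a finite set of natural numbers, so the alphabet of the
  underlying fixed point is taken of this form.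
\<close>

definition automatic :: "nat \<Rightarrow> (nat \<Rightarrow> 'b) \<Rightarrow> bool" where
  "automatic d s \<longleftrightarrow>
     (\<exists>(B :: nat set) \<tau> v \<pi>.
        finite B \<and> morphism_on B \<tau> \<and> uniform_on B d \<tau> \<and>
        range v \<subseteq> B \<and> fixed_point \<tau> v \<and> (\<forall>n. s n = \<pi> (v n)))"

end

theory Submission
  imports Defs
begin

text \<open>
  Cut \<open>u\<close> into blocks \<open>q (u n) @ p\<close> of length \<open>d\<close>; for either form of class P such a block starts
  at every position \<open>d * n + c\<close> with a fixed offset \<open>c\<close>. If the alphabet has more than one letter, the
  first letter of \<open>q (u n)\<close> determines \<open>u n\<close>, hence the whole block, and it is also the last letter
  of \<open>q (u n)\<close>.

  The heart of the proof is that a long palindrome must be symmetric with respect to this cutting.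
  The reflection of a palindrome carries each block to a block of the same shape, because \<open>p\<close> and
  all \<open>q a\<close> are palindromes. If the reflected blocks are shifted against the original ones by
  \<open>\<delta>\<close> with \<open>0 < \<delta> < d\<close>, then a block contains the first letter of the reflected block that starts
  inside it, and that block contains the first letter of the next original one. So \<open>u n\<close>
  determines \<open>u (n + 1)\<close> throughout the palindrome (lemma \<open>misaligned_deterministic\<close>). By primitivity
  every long window of \<open>u\<close> contains every short factor of \<open>u\<close>. Hence there are two cases.

  If \<open>u n\<close> determines \<open>u (n + 1)\<close> everywhere, then \<open>u\<close> is periodic, so its palindrome complexity is
  eventually periodic and therefore automatic. This includes the alphabets with a single letter.

  Otherwise every sufficiently long palindrome is aligned with the blocks. It is then the centered
  part of \<open>p @ concat (map (\<lambda>a. q a @ p) w)\<close> for a palindrome \<open>w\<close> in \<open>u\<close> that is about \<open>d\<close> times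
  shorter, and it determines \<open>w\<close> once the length \<open>l\<close> of \<open>w\<close> is fixed. The lengths \<open>l\<close> that can occur for palindromes of
  length \<open>k\<close> are at most two consecutive numbers, and a parity argument leaves at most one \<open>l\<close> with
  a nonzero count. This gives, for large \<open>k\<close>, a recurrence that expresses the palindrome complexity
  at \<open>k\<close> as a sum of its values at the admissible \<open>l\<close>, of which at most one is nonzero
  (lemma \<open>pal_complexity_sum_parents\<close>). It follows that the palindrome complexity is bounded, and
  that for large \<open>n\<close> the three values starting at \<open>n\<close> determine the three values starting at
  \<open>d * n + j\<close> for every \<open>j < d\<close>. Such a finite amount of information, propagated from \<open>n\<close> to \<open>d * n + j\<close>, is the
  state of a morphism of length \<open>d\<close>.
\<close>

section \<open>Sequences generated by a finite congruence\<close>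

lemma concat_map_uniform_nth:
  assumes "\<forall>x\<in>set xs. length (f x) = d" and "n < length xs" and "r < d"
  shows "concat (map f xs) ! (d * n + r) = f (xs ! n) ! r"
  using assms
proof (induction xs arbitrary: n)
  case (Cons x xs)
  show ?case
  proof (cases n)
    case 0
    then show ?thesis using Cons.prems by (simp add: nth_append)
  next
    case (Suc l)
    have "concat (map f (x # xs)) ! (d * n + r) = concat (map f xs) ! (d * l + r)"
      using Cons.prems(1) Suc by (simp add: nth_append)
    then show ?thesis using Cons.IH[of l] Cons.prems Suc by simp
  qed
qed simp

lemma length_concat_map_uniform:
  assumes "\<forall>x\<in>set xs. length (f x) = d"
  shows "length (concat (map f xs)) = d * length xs"
  using assms by (induction xs) auto

text \<open>
  The values of \<open>F\<close> are the letters of the alphabet: the \<open>j\<close>-th letter of the image of \<open>F n\<close> has to be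
  \<open>F (d * n + j)\<close>, which by hypothesis depends on the letter \<open>F n\<close> alone. With this morphism \<open>F\<close> itself
  is a fixed point.
\<close>

lemma automatic_of_finite_congruence:
  fixes F :: "nat \<Rightarrow> 'c" and s :: "nat \<Rightarrow> 'b"
  assumes d: "0 < d" and fin: "finite (range F)"
    and step: "\<And>n n' j. F n = F n' \<Longrightarrow> j < d \<Longrightarrow> F (d * n + j) = F (d * n' + j)"
    and out: "\<And>n n'. F n = F n' \<Longrightarrow> s n = s n'"
  shows "automatic d s"
proof -
  obtain code :: "'c \<Rightarrow> nat" where code: "inj_on code (range F)"
    using finite_imp_inj_to_nat_seg[OF fin] by blast
  define v where "v n = code (F n)" for n
  have v_eq: "v n = v n' \<longleftrightarrow> F n = F n'" for n n'
    using code unfolding v_def by (auto dest: inj_onD)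
  define rep where "rep b = (SOME n. v n = b)" for b
  have rep: "F (rep (v n)) = F n" for n
    using someI[of "\<lambda>l. v l = v n" n] unfolding rep_def by (simp add: v_eq)
  define \<tau> where "\<tau> b = map (\<lambda>j. v (d * rep b + j)) [0..<d]" for b
  have \<tau>_v: "\<tau> (v n) = map (\<lambda>j. v (d * n + j)) [0..<d]" for n
    unfolding \<tau>_def using step[OF rep] by (simp add: v_eq)
  have image: "apply_word \<tau> (map v [0..<n]) = map v [0..<d * n]" for n
  proof (induction n)
    case (Suc n)
    have "map (\<lambda>j. v (d * n + j)) [0..<d] = map v [d * n..<d * n + d]"
      by (rule nth_equalityI) auto
    moreover have "[0..<d * Suc n] = [0..<d * n] @ [d * n..<d * n + d]"
      using upt_add_eq_append[of 0 "d * n" d] by (simp add: add.commute)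
    ultimately show ?case using Suc \<tau>_v by (simp add: apply_word_def)
  qed (simp add: apply_word_def)
  have "fixed_point \<tau> v"
    unfolding fixed_point_def seq_image_def
  proof
    fix n
    have "[0..<d * n] = [0..<n] @ [n..<d * n]"
      using d upt_add_eq_append[of 0 n "d * n - n"] by simp
    then show "\<exists>m. prefix (map v [0..<n]) (apply_word \<tau> (map v [0..<m]))"
      using image[of n] by (metis map_append prefixI)
  qed
  moreover have "finite (range v)"
    using finite_imageI[OF fin, of code] unfolding v_def by (simp add: image_image)
  moreover have "morphism_on (range v) \<tau>" "uniform_on (range v) d \<tau>"
    unfolding morphism_on_def uniform_on_def by (auto simp: \<tau>_def)
  moreover have "s n = (s \<circ> rep) (v n)" for n
    using out[OF rep[of n]] by simp
  ultimately show ?thesis unfolding automatic_def by blast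
qed

text \<open>
  Both \<open>n mod P\<close> and the truncation \<open>min n N\<close> survive the passage from \<open>n\<close> to \<open>d * n + j\<close>, because
  \<open>d * n + j \<ge> n\<close>.
\<close>

lemma automatic_of_eventually_periodic:
  fixes s :: "nat \<Rightarrow> 'b"
  assumes d: "0 < d" and P: "0 < P" and per: "\<And>n. N \<le> n \<Longrightarrow> s (n + P) = s n"
  shows "automatic d s"
proof (rule automatic_of_finite_congruence[where F = "\<lambda>n. (min n N, n mod P)"])
  show "finite (range (\<lambda>n. (min n N, n mod P)))"
    by (rule finite_subset[of _ "{..N} \<times> {..<P}"]) (use P in auto)
next
  fix n n' j
  assume eq: "(min n N, n mod P) = (min n' N, n' mod P)"
  have grow: "min (d * x + j) N = N" if "N \<le> x" for x
    using that d by (simp add: min_absorb2 trans_le_add1 le_trans[of N x "d * x"])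
  have "n = n' \<or> N \<le> n \<and> N \<le> n'" using eq by (auto simp: min_def split: if_splits)
  then have "min (d * n + j) N = min (d * n' + j) N"
  proof
    assume "N \<le> n \<and> N \<le> n'"
    then show ?thesis by (simp only: grow)
  qed (simp only:)
  moreover have "(d * n + j) mod P = (d * n' + j) mod P"
    using eq by (intro mod_add_cong mod_mult_cong) auto
  ultimately show "(min (d * n + j) N, (d * n + j) mod P) = (min (d * n' + j) N, (d * n' + j) mod P)"
    by simp
next
  have shift: "s (n + P * t) = s n" if "N \<le> n" for n t
  proof (induction t)
    case (Suc t)
    have "s (n + P * Suc t) = s ((n + P * t) + P)" by (simp add: algebra_simps)
    then show ?case using per[of "n + P * t"] that Suc by simp
  qed simp
  have le: "s n = s n'" if "n \<le> n'" "N \<le> n" "n mod P = n' mod P" for n n'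
  proof -
    have "P dvd n' - n" using mod_eq_dvd_iff_nat[OF that(1), of P] that(3) by simp
    then obtain t where "n' - n = P * t" by (elim dvdE)
    then have "n' = n + P * t" using that by simp
    then show ?thesis using shift[of n t] that by simp
  qed
  fix n n'
  assume eq: "(min n N, n mod P) = (min n' N, n' mod P)"
  show "s n = s n'"
  proof (cases "n < N")
    case True
    then show ?thesis using eq by (auto simp: min_def split: if_splits)
  next
    case False
    then have N: "N \<le> n" "N \<le> n'" using eq by (auto simp: min_def split: if_splits)
    have mod: "n mod P = n' mod P" using eq by simp
    show ?thesis
    proof (cases "n \<le> n'")
      case True
      then show ?thesis by (rule le[OF _ N(1) mod])
    next
      case False
      then show ?thesis using le[OF _ N(2) mod[symmetric]] by simp
    qed
  qed
qed (use d in auto)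

text \<open>
  The state at \<open>n\<close> consists of the values at \<open>n\<close>, \<open>n + 1\<close>, \<open>n + 2\<close> and of \<open>min n N\<close>; the latter
  identifies the finitely many \<open>n\<close> for which the recurrence is not available. The state at
  \<open>d * n + j\<close> with \<open>j < d\<close> involves values up to \<open>d * n + (d - 1) + 2\<close>, whence the range of \<open>j\<close> in the
  recurrence.
\<close>

lemma automatic_of_window_recurrence:
  fixes f :: "nat \<Rightarrow> nat"
  assumes d: "0 < d" and bound: "\<And>n. f n \<le> C"
    and rec: "\<And>n n' j. N \<le> n \<Longrightarrow> N \<le> n' \<Longrightarrow> (\<And>i. i \<le> 2 \<Longrightarrow> f (n + i) = f (n' + i)) \<Longrightarrow>
      j \<le> d + 1 \<Longrightarrow> f (d * n + j) = f (d * n' + j)"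
  shows "automatic d (\<lambda>n. f (Suc n))"
proof (rule automatic_of_finite_congruence[where F = "\<lambda>n. (min n N, map (\<lambda>i. f (n + i)) [0..<3])"])
  let ?L = "{xs. set xs \<subseteq> {..C} \<and> length xs = 3}"
  have "finite ?L" by (rule finite_lists_length_eq) simp
  moreover have "range (\<lambda>n. (min n N, map (\<lambda>i. f (n + i)) [0..<3])) \<subseteq> {..N} \<times> ?L"
    using bound by (simp add: image_subset_iff del: upt_Suc)
  ultimately show "finite (range (\<lambda>n. (min n N, map (\<lambda>i. f (n + i)) [0..<3])))"
    by (meson finite_SigmaI finite_atMost finite_subset)
next
  fix n n' j
  assume "(min n N, map (\<lambda>i. f (n + i)) [0..<3]) = (min n' N, map (\<lambda>i. f (n' + i)) [0..<3])"
  then have m: "min n N = min n' N" and "\<forall>i\<in>set [0..<3]. f (n + i) = f (n' + i)"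
    unfolding prod.inject map_eq_conv by blast+
  then have w: "f (n + i) = f (n' + i)" if "i \<le> 2" for i using that by simp
  show "f (Suc n) = f (Suc n')" using w[of 1] by simp
  assume j: "j < d"
  show "(min (d * n + j) N, map (\<lambda>i. f (d * n + j + i)) [0..<3]) =
    (min (d * n' + j) N, map (\<lambda>i. f (d * n' + j + i)) [0..<3])"
  proof (cases "n < N")
    case True
    then have "n = n'" using m by (auto simp: min_def split: if_splits)
    then show ?thesis by simp
  next
    case False
    then have N: "N \<le> n" "N \<le> n'" using m by (auto simp: min_def split: if_splits)
    have grow: "min (d * x + j) N = N" if "N \<le> x" for x
      using that d by (simp add: min_absorb2 trans_le_add1 le_trans[of N x "d * x"])
    note grow[OF N(1)] grow[OF N(2)]
    moreover have "f (d * n + j + i) = f (d * n' + j + i)" if "i < 3" for i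
      using rec[OF N w, of "j + i"] j that by (simp add: add.assoc)
    ultimately show ?thesis by simp
  qed
qed (use d in auto)

section \<open>Palindromic factors\<close>

definition pals :: "(nat \<Rightarrow> 'a) \<Rightarrow> nat \<Rightarrow> 'a list set" where
  "pals u k = {w. length w = k \<and> palindrome w \<and> factor w u}"

lemma pal_complexity_card: "pal_complexity u k = card (pals u k)"
  by (simp add: pal_complexity_def pals_def)

lemma palindrome_nth:
  "palindrome w \<longleftrightarrow> (\<forall>x<length w. w ! x = w ! (length w - 1 - x))"
proof -
  have "palindrome w \<longleftrightarrow> (\<forall>x<length w. rev w ! x = w ! x)"
    by (simp add: palindrome_def list_eq_iff_nth_eq)
  also have "\<dots> \<longleftrightarrow> (\<forall>x<length w. w ! x = w ! (length w - 1 - x))"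
    by (rule all_cong) (auto simp: rev_nth)
  finally show ?thesis .
qed

lemma palindrome_mirror:
  assumes "palindrome w" and "x < length w"
  shows "w ! (length w - 1 - x) = w ! x"
  using assms palindrome_nth[of w] by metis

text \<open>
  The equation \<open>a + b + 1 = 2 * i + k\<close> says that \<open>a\<close> and \<open>b\<close> are exchanged by the reflection of the
  window of length \<open>k\<close> at \<open>i\<close>. In this form the reflection needs no subtraction.
\<close>

definition symmetric_window :: "(nat \<Rightarrow> 'a) \<Rightarrow> nat \<Rightarrow> nat \<Rightarrow> bool" where
  "symmetric_window u i k \<longleftrightarrow>
    (\<forall>a b. a + b + 1 = 2 * i + k \<longrightarrow> i \<le> a \<longrightarrow> a < i + k \<longrightarrow> u a = u b)"

lemma symmetric_windowD:
  assumes "symmetric_window u i k" and "a + b + 1 = 2 * i + k" and "i \<le> a" and "a < i + k"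
  shows "u a = u b"
  using assms unfolding symmetric_window_def by blast

lemma symmetric_windowI:
  assumes "\<And>a b. a + b + 1 = 2 * i + k \<Longrightarrow> i \<le> a \<Longrightarrow> a < i + k \<Longrightarrow> u a = u b"
  shows "symmetric_window u i k"
  using assms unfolding symmetric_window_def by blast

lemma palindrome_window:
  "palindrome (map u [i..<i + k]) \<longleftrightarrow> symmetric_window u i k"
proof
  assume pal: "palindrome (map u [i..<i + k])"
  show "symmetric_window u i k"
  proof (rule symmetric_windowI)
    fix a b
    assume ab: "a + b + 1 = 2 * i + k" "i \<le> a" "a < i + k"
    define x where "x = a - i"
    have x: "x < k" "a = i + x" "b = i + (k - 1 - x)" using ab unfolding x_def by auto
    show "u a = u b"
      using palindrome_mirror[OF pal, of x] x(1) unfolding x(2,3) by (simp del: upt_Suc)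
  qed
next
  assume symm: "symmetric_window u i k"
  have "u (i + x) = u (i + (k - 1 - x))" if "x < k" for x
    by (rule symmetric_windowD[OF symm]) (use that in auto)
  then show "palindrome (map u [i..<i + k])"
    unfolding palindrome_nth by (simp del: upt_Suc)
qed

lemma palsE:
  assumes "w \<in> pals u k"
  obtains i where "w = map u [i..<i + k]" and "symmetric_window u i k"
proof -
  obtain i where i: "w = map u [i..<i + k]" and "palindrome w"
    using assms unfolding pals_def factor_def by auto
  then show thesis using that[OF i] palindrome_window[of u i k] by simp
qed

lemma palsI:
  assumes "symmetric_window u i k"
  shows "map u [i..<i + k] \<in> pals u k"
proof -
  have "palindrome (map u [i..<i + k])" using assms unfolding palindrome_window by blast
  then show ?thesis unfolding pals_def factor_def by auto
qed

text \<open>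
  A factor of length at least \<open>P\<close> of a sequence with period \<open>P\<close> extends to the right by \<open>P\<close> letters in
  exactly one way. The extension moves the center by \<open>P / 2\<close>, which turns one symmetry of a periodic
  word into another one.
\<close>

lemma pal_complexity_periodic:
  assumes per: "\<And>n. u (n + P) = u n" and k: "P \<le> k"
  shows "pal_complexity u (k + P) = pal_complexity u k"
proof -
  have "bij_betw (take k) (pals u (k + P)) (pals u k)"
    unfolding bij_betw_def
  proof
    show "inj_on (take k) (pals u (k + P))"
    proof (rule inj_onI)
      fix w w'
      assume w: "w \<in> pals u (k + P)" and w': "w' \<in> pals u (k + P)" and eq: "take k w = take k w'"
      have shift: "y ! x = y ! (x - P)" if y: "y \<in> pals u (k + P)" and x: "k \<le> x" "x < k + P" for x y
      proof -
        obtain i where i: "y = map u [i..<i + (k + P)]" using y by (rule palsE)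
        have "y ! x = u (i + x)" "y ! (x - P) = u (i + (x - P))"
          using x k unfolding i by (simp_all del: upt_Suc)
        then show ?thesis using per[of "i + (x - P)"] x k by simp
      qed
      have len: "length w = k + P" "length w' = k + P" using w w' by (auto simp: pals_def)
      show "w = w'"
      proof (rule nth_equalityI)
        fix x
        assume x: "x < length w"
        have low: "w ! y = w' ! y" if "y < k" for y using eq that by (metis nth_take)
        show "w ! x = w' ! x"
        proof (cases "x < k")
          case False
          then have "x - P < k" using x len k by linarith
          then show ?thesis using shift[OF w, of x] shift[OF w', of x] low False x len by simp
        qed (rule low)
      qed (simp add: len)
    qed
    show "take k ` pals u (k + P) = pals u k"
    proof (intro subset_antisym subsetI)
      fix y
      assume "y \<in> take k ` pals u (k + P)"
      then obtain w where w: "w \<in> pals u (k + P)" and y: "y = take k w" by blast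
      from w obtain i where i: "w = map u [i..<i + (k + P)]"
        and symm: "symmetric_window u i (k + P)"
        by (rule palsE)
      have "y = map u [i..<i + k]" unfolding y i by (simp add: take_map)
      moreover have "map u [i..<i + k] \<in> pals u k"
      proof (intro palsI symmetric_windowI)
        fix a b
        assume "a + b + 1 = 2 * i + k" "i \<le> a" "a < i + k"
        then show "u a = u b" using symmetric_windowD[OF symm, of a "b + P"] per[of b] by simp
      qed
      ultimately show "y \<in> pals u k" by simp
    next
      fix y
      assume "y \<in> pals u k"
      then obtain i where y: "y = map u [i..<i + k]"
        and symm: "symmetric_window u i k"
        by (rule palsE)
      have "map u [i..<i + (k + P)] \<in> pals u (k + P)"
      proof (intro palsI symmetric_windowI)
        fix a b
        assume ab: "a + b + 1 = 2 * i + (k + P)" "i \<le> a" "a < i + (k + P)"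
        show "u a = u b"
        proof (cases "a < i + k")
          case True
          then have "u a = u (b - P)" by (intro symmetric_windowD[OF symm]) (use ab in auto)
          moreover have "P \<le> b" using ab True by simp
          ultimately show ?thesis using per[of "b - P"] by simp
        next
          case False
          then have "u (a - P) = u b" by (intro symmetric_windowD[OF symm]) (use ab k in auto)
          then show ?thesis using per[of "a - P"] k False by simp
        qed
      qed
      moreover have "y = take k (map u [i..<i + (k + P)])" unfolding y by (simp add: take_map)
      ultimately show "y \<in> take k ` pals u (k + P)" by blast
    qed
  qed
  then show ?thesis unfolding pal_complexity_card by (rule bij_betw_same_card)
qed

section \<open>Fixed points of primitive uniform morphisms\<close>

text \<open>
  The contribution of uniformity is that \<open>u (d * x + r)\<close> is a function of \<open>u x\<close> and \<open>r\<close>, and the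
  contribution of primitivity is that every letter recurs with bounded gaps. Stated for the sequence
  alone, they make arguments about positions independent of the morphism.
\<close>

locale uniform_recurrent =
  fixes u :: "nat \<Rightarrow> 'a" and d K :: nat
  assumes d_pos: "0 < d"
    and step: "\<And>x y r. u x = u y \<Longrightarrow> r < d \<Longrightarrow> u (d * x + r) = u (d * y + r)"
    and gap: "\<And>n b. \<exists>x. n \<le> x \<and> x < n + K \<and> u x = u b"
begin

lemma step_power:
  assumes "u x = u y" and "r < d ^ j"
  shows "u (d ^ j * x + r) = u (d ^ j * y + r)"
  using assms(2)
proof (induction j arbitrary: r)
  case (Suc j)
  have "r div d < d ^ j" using Suc.prems d_pos by (simp add: div_less_iff_less_mult mult.commute)
  then have "u (d * (d ^ j * x + r div d) + r mod d) = u (d * (d ^ j * y + r div d) + r mod d)"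
    using Suc.IH d_pos by (intro step) auto
  then show ?case by (simp add: algebra_simps)
qed (use assms(1) in simp)

text \<open>
  Recurrence with bounded gaps passes from letters to factors: each factor lies in a prefix of length
  \<open>d ^ j\<close>, and this prefix is reproduced at \<open>d ^ j * x\<close> whenever \<open>u x = u 0\<close>.
\<close>

lemma gap_power:
  "\<exists>z\<ge>n. z + d ^ j \<le> n + d ^ j * (K + 1) \<and> (\<forall>r<d ^ j. u (z + r) = u r)"
proof -
  let ?D = "d ^ j"
  have D: "0 < ?D" using d_pos by simp
  define n0 where "n0 = (n + ?D - 1) div ?D"
  have n0: "n \<le> ?D * n0" "?D * n0 < n + ?D"
  proof -
    have "?D * n0 + (n + ?D - 1) mod ?D = n + ?D - 1" unfolding n0_def by simp
    moreover have "(n + ?D - 1) mod ?D < ?D" using D by simp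
    ultimately show "n \<le> ?D * n0" "?D * n0 < n + ?D" using D by linarith+
  qed
  obtain x where x: "n0 \<le> x" "x < n0 + K" "u x = u 0" using gap by blast
  have "?D * n0 \<le> ?D * x" using x by simp
  moreover have "?D * (x + 1) \<le> ?D * (n0 + K)" using x by (intro mult_left_mono) auto
  moreover have "\<forall>r<?D. u (?D * x + r) = u r" using step_power[OF x(3)] by simp
  moreover have "n \<le> ?D * x" "?D * x + ?D \<le> n + ?D * (K + 1)"
    using calculation(1,2) n0 unfolding distrib_left mult_1_right by linarith+
  ultimately show ?thesis by blast
qed

lemma exists_power_ge:
  assumes "2 \<le> d"
  shows "\<exists>j. n \<le> d ^ j"
proof -
  have "n \<le> 2 ^ n" using less_exp[of n] by simp
  also have "\<dots> \<le> d ^ n" using assms by (rule power_mono) simp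
  finally show ?thesis by blast
qed

lemma factor_recurs:
  assumes "2 \<le> d"
  shows "\<exists>z\<ge>n. \<forall>x<k. u (z + x) = u (i + x)"
proof -
  obtain j where j: "i + k \<le> d ^ j" using exists_power_ge[OF assms] by blast
  obtain z where z: "n \<le> z" "\<And>r. r < d ^ j \<Longrightarrow> u (z + r) = u r" using gap_power[of n j] by blast
  have "u (z + i + x) = u (i + x)" if "x < k" for x
    using z(2)[of "i + x"] that j by (simp add: add.assoc)
  then show ?thesis using z(1) by (intro exI[of _ "z + i"]) auto
qed

lemma pals_recurs:
  assumes "2 \<le> d" and "w \<in> pals u k"
  obtains i where "n \<le> i" and "w = map u [i..<i + k]"
    and "symmetric_window u i k"
proof -
  obtain h where h: "w = map u [h..<h + k]" using assms(2) by (rule palsE)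
  obtain z where z: "n \<le> z" "\<forall>x<k. u (z + x) = u (h + x)" using factor_recurs[OF assms(1)] by blast
  have w: "w = map u [z..<z + k]" unfolding h by (rule nth_equalityI) (use z in auto)
  moreover have "palindrome w" using assms(2) by (simp add: pals_def)
  ultimately show ?thesis using that[of z] z(1) palindrome_window[of u z k] by blast
qed

text \<open>
  A sequence over a finite alphabet in which each letter determines the next is eventually periodic.
  The period extends back to position \<open>0\<close> because every letter recurs in the periodic part.
\<close>

lemma periodic_of_deterministic:
  assumes fin: "finite (range u)" and det: "\<And>n n'. u n = u n' \<Longrightarrow> u (n + 1) = u (n' + 1)"
  shows "\<exists>P>0. \<forall>n. u (n + P) = u n"
proof -
  have "\<not> inj u" using fin finite_imageD[of u UNIV] infinite_UNIV_nat by blast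
  then obtain x y where xy: "x < y" "u x = u y" unfolding inj_def by (metis linorder_neqE_nat)
  have det_add: "u (n + t) = u (n' + t)" if "u n = u n'" for n n' t
  proof (induction t)
    case (Suc t)
    then show ?case using det[of "n + t" "n' + t"] by simp
  qed (use that in simp)
  have "u (n + (y - x)) = u n" for n
  proof -
    obtain n' where n': "x \<le> n'" "u n' = u n" using gap by blast
    have "u (x + (n' - x)) = u (y + (n' - x))" by (rule det_add[OF xy(2)])
    then have "u n' = u (n' + (y - x))" using n' xy by (simp add: add.commute)
    then show ?thesis using det_add[OF n'(2), of "y - x"] n'(2) by simp
  qed
  then show ?thesis using xy by (intro exI[of _ "y - x"]) auto
qed

end

lemma fixed_point_nth:
  assumes fp: "fixed_point \<sigma> u" and len: "\<And>n. length (\<sigma> (u n)) = d" and r: "r < d"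
  shows "u (d * n + r) = \<sigma> (u n) ! r"
proof -
  let ?N = "Suc (d * n + r)"
  obtain m where m: "prefix (map u [0..<?N]) (apply_word \<sigma> (map u [0..<m]))"
    using fp unfolding fixed_point_def seq_image_def by blast
  then obtain zs where zs: "apply_word \<sigma> (map u [0..<m]) = map u [0..<?N] @ zs" by (rule prefixE)
  have lens: "\<forall>a\<in>set (map u [0..<m]). length (\<sigma> a) = d" using len by auto
  have "length (apply_word \<sigma> (map u [0..<m])) = d * m"
    unfolding apply_word_def by (subst length_concat_map_uniform[OF lens]) auto
  then have "?N \<le> d * m" using prefix_length_le[OF m] by simp
  then have "d * n < d * m" by linarith
  then have nm: "n < m" by simp
  have "apply_word \<sigma> (map u [0..<m]) ! (d * n + r) = \<sigma> (u n) ! r"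
    using concat_map_uniform_nth[OF lens, of n r] nm r by (simp add: apply_word_def)
  moreover have "apply_word \<sigma> (map u [0..<m]) ! (d * n + r) = u (d * n + r)"
    unfolding zs by (simp add: nth_append del: upt_Suc)
  ultimately show ?thesis by simp
qed

lemma fixed_point_power:
  assumes fp: "fixed_point \<sigma> u" and len: "\<And>n. length (\<sigma> (u n)) = d"
  shows "(apply_word \<sigma> ^^ k) [u n] = map u [d ^ k * n..<d ^ k * n + d ^ k]"
proof (induction k)
  case (Suc k)
  have lens: "\<forall>a\<in>set (map u [x..<y]). length (\<sigma> a) = d" for x y using len by auto
  have image: "apply_word \<sigma> (map u [x..<x + y]) = map u [d * x..<d * x + d * y]" for x y
  proof (rule nth_equalityI)
    have size: "length (apply_word \<sigma> (map u [x..<x + y])) = d * y"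
      unfolding apply_word_def by (subst length_concat_map_uniform[OF lens]) auto
    then show "length (apply_word \<sigma> (map u [x..<x + y])) = length (map u [d * x..<d * x + d * y])"
      by simp
    fix z
    assume "z < length (apply_word \<sigma> (map u [x..<x + y]))"
    then have z: "z < d * y" using size by simp
    then have d: "0 < d" by (cases d) auto
    have zy: "z div d < y" using z d by (simp add: div_less_iff_less_mult mult.commute)
    have "apply_word \<sigma> (map u [x..<x + y]) ! (d * (z div d) + z mod d) = \<sigma> (u (x + z div d)) ! (z mod d)"
      using concat_map_uniform_nth[OF lens, of "z div d" x "x + y" "z mod d"] zy d
      by (simp add: apply_word_def)
    also have "\<dots> = u (d * (x + z div d) + z mod d)"
      using fixed_point_nth[OF fp len] d by simp
    finally show "apply_word \<sigma> (map u [x..<x + y]) ! z = map u [d * x..<d * x + d * y] ! z"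
      using z by (simp add: algebra_simps)
  qed
  show ?case using Suc image[of "d ^ k * n" "d ^ k"] by (simp add: mult.assoc)
qed simp

text \<open>
  If \<open>k\<close> witnesses primitivity, then each of the words of length \<open>d ^ k\<close> at multiples of \<open>d ^ k\<close>
  contains all letters, and every window of twice this length contains such a word.
\<close>

lemma uniform_recurrent_fixed_point:
  assumes prim: "primitive_on A \<sigma>" and u: "range u \<subseteq> A" and fp: "fixed_point \<sigma> u"
    and unif: "uniform_on A d \<sigma>" and d: "0 < d"
  shows "\<exists>K. uniform_recurrent u d K"
proof -
  have len: "length (\<sigma> (u n)) = d" for n using u unif unfolding uniform_on_def by auto
  obtain k where k: "\<forall>a\<in>A. \<forall>b\<in>A. b \<in> set ((apply_word \<sigma> ^^ k) [a])"
    using prim unfolding primitive_on_def by blast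
  let ?D = "d ^ k"
  have "uniform_recurrent u d (2 * ?D)"
  proof
    show "0 < d" by fact
    fix x y r
    assume "u x = u y" "r < d"
    then show "u (d * x + r) = u (d * y + r)" using fixed_point_nth[OF fp len] by simp
  next
    fix n b
    let ?n = "n div ?D + 1"
    have "u b \<in> set ((apply_word \<sigma> ^^ k) [u ?n])" using k u by blast
    then have "u b \<in> u ` {?D * ?n..<?D * ?n + ?D}" using fixed_point_power[OF fp len] by simp
    then obtain x where x: "?D * ?n \<le> x" "x < ?D * ?n + ?D" "u x = u b" by auto
    have "?D * (n div ?D) + n mod ?D = n" "n mod ?D < ?D" using d by simp_all
    moreover have "?D * ?n = ?D * (n div ?D) + ?D" by simp
    ultimately have "n \<le> x" "x < n + 2 * ?D" using x by linarith+
    then show "\<exists>x. n \<le> x \<and> x < n + 2 * ?D \<and> u x = u b" using x by blast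
  qed
  then show ?thesis by blast
qed

section \<open>Recognizability of long palindromes\<close>

text \<open>
  Position \<open>c\<close> is the offset at which the blocks \<open>q (u n) @ p\<close> start. It is \<open>length p\<close> if the morphism
  is \<open>a \<mapsto> p @ q a\<close>, as then \<open>q (u n)\<close> is followed by the \<open>p\<close> of the next image, and \<open>0\<close> if it is
  \<open>a \<mapsto> q a @ p\<close>. This treats both forms of class P at once.
\<close>

locale marked_class_P = uniform_recurrent u d K
  for u :: "nat \<Rightarrow> 'a" and d K :: nat +
  fixes p :: "'a list" and q :: "'a \<Rightarrow> 'a list" and c :: nat
  assumes d_ge_2: "2 \<le> d"
    and pal_p: "palindrome p" and pal_q: "\<And>n. palindrome (q (u n))"
    and length_q: "\<And>n. length p + length (q (u n)) = d"
    and q_nonempty: "\<And>n. q (u n) \<noteq> []"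
    and marked: "\<And>x y. hd (q (u x)) = hd (q (u y)) \<Longrightarrow> u x = u y"
    and block: "\<And>n x. x < d \<Longrightarrow> u (d * n + c + x) = (q (u n) @ p) ! x"
    and c_le: "c \<le> length p"
begin

text \<open>
  The common length of the words \<open>q (u n)\<close>.
\<close>

definition r where "r = d - length p"

lemma length_q_eq: "length (q (u n)) = r" and length_p: "length p + r = d" and r_pos: "0 < r"
  using length_q[of n] length_q[of 0] q_nonempty[of 0] unfolding r_def by auto

lemma q_mirror: "x < r \<Longrightarrow> q (u n) ! (r - 1 - x) = q (u n) ! x"
  using palindrome_mirror[OF pal_q, of x n] by (simp add: length_q_eq)

lemma p_mirror: "x < length p \<Longrightarrow> p ! (length p - 1 - x) = p ! x"
  by (rule palindrome_mirror[OF pal_p])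

lemma block_q: "x < r \<Longrightarrow> u (d * n + c + x) = q (u n) ! x"
  using block[of x n] length_p by (simp add: nth_append length_q_eq)

lemma block_p: "x < length p \<Longrightarrow> u (d * n + c + r + x) = p ! x"
  using block[of "r + x" n] length_p by (simp add: nth_append length_q_eq add.assoc)

lemma block_start: "u (d * n + c) = hd (q (u n))"
  using block_q[of 0 n] r_pos q_nonempty[of n] by (simp add: hd_conv_nth)

lemma block_q_end: "u (d * n + c + (r - 1)) = hd (q (u n))"
  using block_q[of "r - 1" n] q_mirror[of 0 n] r_pos q_nonempty[of n] by (simp add: hd_conv_nth)

text \<open>
  The equation for \<open>2 * i + k\<close> says that the reflection carries the occurrence of \<open>q (u n)\<close> at
  \<open>d * n + c\<close> to the positions starting at \<open>d * y + c + \<delta>\<close>. Since \<open>q (u n)\<close> and the copy of \<open>p\<close> in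
  front of it are palindromes, reflection turns \<open>p @ q (u n)\<close> into \<open>q (u n) @ p\<close>. The copy of \<open>p\<close> in
  front is part of the previous block, whence \<open>1 \<le> n\<close>.
\<close>

lemma reflected_block:
  assumes symm: "symmetric_window u i k"
    and center: "2 * i + k = r + 2 * c + d * (y + n) + \<delta>" and n: "1 \<le> n"
    and low: "i \<le> d * y + c" and high: "d * y + c + \<delta> + d \<le> i + k" and x: "x < d"
  shows "u (d * y + c + \<delta> + x) = (q (u n) @ p) ! x"
proof (cases "x < r")
  case True
  have "u (d * y + c + \<delta> + x) = u (d * n + c + (r - 1 - x))"
    by (rule symmetric_windowD[OF symm]) (use center low high x True in \<open>auto simp: algebra_simps\<close>)
  also have "\<dots> = q (u n) ! x" using block_q[of "r - 1 - x" n] q_mirror True by simp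
  finally show ?thesis using True by (simp add: nth_append length_q_eq)
next
  case False
  obtain n' where n': "n = Suc n'" using n by (cases n) auto
  have xr: "x - r < length p" using False x length_p by simp
  have "u (d * y + c + \<delta> + x) = u (d * n' + c + r + (length p - 1 - (x - r)))"
    by (rule symmetric_windowD[OF symm])
      (use center low high x False length_p xr in \<open>auto simp: algebra_simps n'\<close>)
  also have "\<dots> = p ! (x - r)" using block_p[of "length p - 1 - (x - r)" n'] p_mirror[OF xr] xr by simp
  finally show ?thesis using False by (simp add: nth_append length_q_eq)
qed

text \<open>
  Let the reflected block with letter \<open>u m\<close> start \<open>\<delta>\<close> positions after the block with letter \<open>u y\<close>.
  The first letter of the reflected block lies in the block of \<open>u y\<close>, so \<open>u y\<close> determines \<open>u m\<close>. The
  first letter of the next block, \<open>d - \<delta>\<close> positions further right, lies in the reflected block, so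
  \<open>u m\<close> determines \<open>u (y + 1)\<close>. As \<open>\<delta>\<close> is the same for all blocks, so is this dependence.
\<close>

lemma misaligned_deterministic:
  assumes symm: "symmetric_window u i k"
    and i: "2 * d \<le> i"
    and center: "2 * i + k = r + 2 * c + d * T + \<delta>" and \<delta>: "0 < \<delta>" "\<delta> < d"
    and y: "i \<le> d * y + c" "d * y + c + 2 * d \<le> i + k"
    and z: "i \<le> d * z + c" "d * z + c + 2 * d \<le> i + k"
    and eq: "u y = u z"
  shows "u (y + 1) = u (z + 1)"
proof -
  \<comment> \<open>The bound on \<open>i\<close> keeps the reflected blocks away from block \<open>0\<close>.\<close>
  have index: "\<exists>n\<ge>1. T = x + n" if "d * x + c + 2 * d \<le> i + k" for x
  proof -
    have "d * (x + 1) \<le> d * T"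
      using that i center \<delta> c_le length_p unfolding distrib_left mult_1_right by linarith
    then have "x + 1 \<le> T" by (rule mult_left_le_imp_le[OF _ d_pos])
    then show ?thesis by (intro exI[of _ "T - x"]) auto
  qed
  obtain m where m: "1 \<le> m" "T = y + m" using index[OF y(2)] by blast
  obtain n where n: "1 \<le> n" "T = z + n" using index[OF z(2)] by blast
  have ry: "u (d * y + c + \<delta> + x) = (q (u m) @ p) ! x" if "x < d" for x
    by (rule reflected_block[OF symm _ m(1) y(1) _ that]) (use center m y \<delta> in auto)
  have rz: "u (d * z + c + \<delta> + x) = (q (u n) @ p) ! x" if "x < d" for x
    by (rule reflected_block[OF symm _ n(1) z(1) _ that]) (use center n z \<delta> in auto)
  have "hd (q (u m)) = u (d * y + c + \<delta>)"
    using ry[of 0] d_pos q_nonempty[of m] by (simp add: nth_append hd_conv_nth)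
  also have "\<dots> = u (d * z + c + \<delta>)" using block[OF \<delta>(2)] eq by simp
  also have "\<dots> = hd (q (u n))"
    using rz[of 0] d_pos q_nonempty[of n] by (simp add: nth_append hd_conv_nth)
  finally have mn: "u m = u n" by (rule marked)
  have "hd (q (u (y + 1))) = u (d * y + c + \<delta> + (d - \<delta>))"
    using block_start[of "y + 1"] \<delta> by (simp add: algebra_simps)
  also have "\<dots> = u (d * z + c + \<delta> + (d - \<delta>))" using ry[of "d - \<delta>"] rz[of "d - \<delta>"] mn \<delta> by simp
  also have "\<dots> = hd (q (u (z + 1)))"
    using block_start[of "z + 1"] \<delta> by (simp add: algebra_simps)
  finally show ?thesis by (rule marked)
qed

text \<open>
  A long window contains both occurrences of the letter \<open>u y = u z\<close>, with their different successors,
  so a misaligned palindrome around it would contradict the preceding lemma. The equation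
  \<open>2 * i + k = r + 2 * c + d * T\<close> expresses alignment: the reflection exchanges the occurrences of
  \<open>q (u n)\<close> and \<open>q (u (T - n))\<close>.
\<close>

lemma long_palindromes_aligned:
  assumes "u y = u z" and "u (y + 1) \<noteq> u (z + 1)"
  shows "\<exists>N. \<forall>i k. N \<le> k \<longrightarrow> 2 * d \<le> i \<longrightarrow> symmetric_window u i k \<longrightarrow> (\<exists>T. 2 * i + k = r + 2 * c + d * T)"
proof -
  obtain j where j: "y + z + 2 \<le> d ^ j" using exists_power_ge[OF d_ge_2] by blast
  define W where "W = d ^ j * (K + 1)"
  have "\<exists>T. 2 * i + k = r + 2 * c + d * T"
    if k: "d * (W + 4) \<le> k" and i: "2 * d \<le> i"
      and symm: "symmetric_window u i k" for i k
  proof -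
    define T where "T = (2 * i + k - (r + 2 * c)) div d"
    define \<delta> where "\<delta> = (2 * i + k - (r + 2 * c)) mod d"
    have "r + 2 * c \<le> 2 * i + k" using i c_le length_p by simp
    moreover have "d * T + \<delta> = 2 * i + k - (r + 2 * c)" unfolding T_def \<delta>_def by simp
    ultimately have center: "2 * i + k = r + 2 * c + d * T + \<delta>" by simp
    have \<delta>: "\<delta> < d" unfolding \<delta>_def using d_pos by simp
    \<comment> \<open>Rounding \<open>i\<close> up to a block costs less than \<open>d\<close>, the offset \<open>c\<close> another \<open>d\<close>, and the last
      block needs \<open>2 * d\<close> to its right; this is the \<open>4\<close> in the bound on \<open>k\<close>.\<close>
    let ?n = "i div d + 1"
    obtain x where x: "?n \<le> x" "x + d ^ j \<le> ?n + W" "\<And>r. r < d ^ j \<Longrightarrow> u (x + r) = u r"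
      using gap_power[of ?n j] unfolding W_def by blast
    have "d * (i div d) + i mod d = i" "i mod d < d" using d_pos by simp_all
    then have n: "i \<le> d * ?n" "d * ?n \<le> i + d" unfolding distrib_left mult_1_right by linarith+
    have window: "i \<le> d * (x + t) + c" "d * (x + t) + c + 2 * d \<le> i + k" if "t < d ^ j" for t
    proof -
      have "d * ?n \<le> d * (x + t)" using x by (intro mult_left_mono) auto
      then show "i \<le> d * (x + t) + c" using n by linarith
      have "d * (x + t) \<le> d * (?n + W)" using x that by (intro mult_left_mono) auto
      then have "d * (x + t) \<le> i + d + d * W" using n unfolding distrib_left mult_1_right by linarith
      then show "d * (x + t) + c + 2 * d \<le> i + k"
        using k c_le length_p unfolding distrib_left mult_1_right by linarith
    qed
    have "\<delta> = 0"
    proof (rule ccontr)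
      assume "\<delta> \<noteq> 0"
      then have "u (x + y + 1) = u (x + z + 1)"
        by (intro misaligned_deterministic[OF symm i center _ \<delta>])
          (use window[of y] window[of z] x(3)[of y] x(3)[of z] assms(1) j in auto)
      then show False using x(3)[of "y + 1"] x(3)[of "z + 1"] assms(2) j by (simp add: add.assoc)
    qed
    then show ?thesis using center by auto
  qed
  then show ?thesis by blast
qed

end

section \<open>The recurrence for the palindrome complexity\<close>

locale recognizable_class_P = marked_class_P u d K p q c
  for u :: "nat \<Rightarrow> 'a" and d K :: nat and p :: "'a list" and q :: "'a \<Rightarrow> 'a list" and c :: nat +
  fixes N :: nat
  assumes aligned: "\<And>i k. N \<le> k \<Longrightarrow> 2 * d \<le> i \<Longrightarrow>
      symmetric_window u i k \<Longrightarrow> \<exists>T. 2 * i + k = r + 2 * c + d * T"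
begin

text \<open>
  The word \<open>inflate w\<close> is the image of \<open>w\<close> with a copy of \<open>p\<close> added so as to be a palindrome whenever
  \<open>w\<close> is, and \<open>core e k\<close> removes \<open>e\<close> letters from both ends of it if its length is \<open>k + 2 * e\<close>.
\<close>

definition inflate :: "'a list \<Rightarrow> 'a list" where
  "inflate w = p @ concat (map (\<lambda>a. q a @ p) w)"

definition core :: "nat \<Rightarrow> nat \<Rightarrow> 'a list \<Rightarrow> 'a list" where
  "core e k w = take k (drop e (inflate w))"

lemma inflate_window:
  assumes "1 \<le> n"
  shows "inflate (map u [n..<n + l]) =
    map u [d * n + c - length p..<d * n + c - length p + (d * l + length p)]"
proof -
  obtain n' where n': "n = Suc n'" using assms by (cases n) auto
  have start: "d * n + c - length p = d * n' + c + r" using n' length_p by simp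
  have lens: "\<forall>a\<in>set (map u [n..<n + l]). length (q a @ p) = d" using length_q by (auto simp: add.commute)
  have len: "length (inflate (map u [n..<n + l])) = d * l + length p"
    using length_concat_map_uniform[OF lens] by (simp add: inflate_def)
  show ?thesis
    unfolding start
  proof (rule nth_equalityI)
    fix x
    assume "x < length (inflate (map u [n..<n + l]))"
    then have x: "x < d * l + length p" using len by simp
    show "inflate (map u [n..<n + l]) ! x =
      map u [d * n' + c + r..<d * n' + c + r + (d * l + length p)] ! x"
    proof (cases "x < length p")
      case True
      then show ?thesis using block_p[OF True, of n'] x by (simp add: inflate_def nth_append)
    next
      case False
      define t where "t = x - length p"
      have t: "x = length p + t" "t < d * l" using False x unfolding t_def by auto
      then have tl: "t div d < l" using d_pos by (simp add: div_less_iff_less_mult mult.commute)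
      have "inflate (map u [n..<n + l]) ! x
        = concat (map (\<lambda>a. q a @ p) (map u [n..<n + l])) ! (d * (t div d) + t mod d)"
        using t by (simp add: inflate_def)
      also have "\<dots> = (q (u (n + t div d)) @ p) ! (t mod d)"
        by (subst concat_map_uniform_nth[OF lens]) (use tl d_pos in auto)
      also have "\<dots> = u (d * (n + t div d) + c + t mod d)" using block d_pos by simp
      also have "d * (n + t div d) + c + t mod d = d * n' + c + r + x"
        using t(1) length_p by (simp add: n' algebra_simps)
      finally show ?thesis using x by simp
    qed
  qed (simp add: len)
qed

lemma core_window:
  assumes "1 \<le> n" and "d * l + length p = k + 2 * e"
  shows "core e k (map u [n..<n + l]) =
    map u [d * n + c - length p + e..<d * n + c - length p + e + k]"
  unfolding core_def inflate_window[OF assms(1)] assms(2)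
  by (simp add: drop_map take_map)

lemma core_pals:
  assumes w: "w \<in> pals u l" and e: "d * l + length p = k + 2 * e" and l: "1 \<le> l"
  shows "core e k w \<in> pals u k"
proof -
  obtain n where n: "1 \<le> n" and wn: "w = map u [n..<n + l]"
    using pals_recurs[OF d_ge_2 w, of 1] by blast
  let ?s = "d * n + c - length p + e"
  have core: "core e k w = map u [?s..<?s + k]" unfolding wn by (rule core_window[OF n e])
  have "rev (concat (map (\<lambda>a. q a @ p) (map u xs))) = concat (map (\<lambda>a. p @ q a) (rev (map u xs)))" for xs
    using pal_p pal_q by (induction xs) (auto simp: palindrome_def)
  moreover have "concat (map (\<lambda>a. p @ q a) xs) @ p = p @ concat (map (\<lambda>a. q a @ p) xs)" for xs
    by (induction xs) auto
  ultimately have "rev (inflate w) = inflate (rev w)"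
    using pal_p unfolding inflate_def wn by (simp add: palindrome_def)
  then have mirror: "rev (inflate w) = inflate w" using w by (simp add: pals_def palindrome_def)
  have len: "length (inflate w) = k + 2 * e"
    unfolding wn inflate_window[OF n] using e by simp
  have "rev (core e k w) = take k (drop e (rev (inflate w)))"
    unfolding core_def using len by (simp add: rev_take rev_drop drop_take)
  then have "palindrome (core e k w)" unfolding palindrome_def mirror core_def .
  then show ?thesis unfolding pals_def factor_def core by auto
qed

text \<open>
  As \<open>e < d\<close>, the removed letters do not reach the first letter of \<open>q (w ! y)\<close> for \<open>y \<ge> 1\<close>, so these
  letters of \<open>w\<close> can be read off. The letter \<open>w ! 0\<close> is equal to the last one by symmetry.
\<close>

lemma inj_on_core:
  assumes e: "d * l + length p = k + 2 * e" "e < d" and l: "2 \<le> l"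
  shows "inj_on (core e k) (pals u l)"
proof (rule inj_onI)
  fix w w'
  assume w: "w \<in> pals u l" and w': "w' \<in> pals u l" and eq: "core e k w = core e k w'"
  have mark: "core e k v ! (length p + d * y - e) = hd (q (v ! y)) \<and> v ! y \<in> range u"
    if v: "v \<in> pals u l" and y: "1 \<le> y" "y < l" for v y
  proof -
    obtain n where n: "1 \<le> n" and vn: "v = map u [n..<n + l]"
      using pals_recurs[OF d_ge_2 v, of 1] by blast
    have "d * 1 \<le> d * y" "d * 1 \<le> d * n" using y n by (intro mult_left_mono; simp)+
    moreover have "d * (y + 1) \<le> d * l" using y by (intro mult_left_mono) auto
    ultimately have b: "e \<le> length p + d * y" "length p + d * y - e < k" "length p \<le> d * n"
      using e length_p unfolding distrib_left mult_1_right by linarith+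
    have "core e k v ! (length p + d * y - e) = u (d * n + c - length p + e + (length p + d * y - e))"
      unfolding vn core_window[OF n e(1)] using b by simp
    also have "d * n + c - length p + e + (length p + d * y - e) = d * (n + y) + c"
      using b by (simp add: algebra_simps)
    finally show ?thesis using block_start y unfolding vn by simp
  qed
  have pos: "w ! y = w' ! y" if y: "1 \<le> y" "y < l" for y
    using mark[OF w y] mark[OF w' y] eq marked by fastforce
  have len: "length w = l" "length w' = l" using w w' by (auto simp: pals_def)
  have ends: "v ! 0 = v ! (l - 1)" if "v \<in> pals u l" for v
    using that l palindrome_mirror[of v 0] by (simp add: pals_def)
  show "w = w'"
  proof (rule nth_equalityI)
    fix y
    assume "y < length w"
    then have "y = 0 \<or> 1 \<le> y \<and> y < l" using len by auto
    moreover have "w ! 0 = w' ! 0"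
      unfolding ends[OF w] ends[OF w'] by (rule pos) (use l in auto)
    ultimately show "w ! y = w' ! y" using pos by blast
  qed (simp add: len)
qed

text \<open>
  The lengths of the palindromes from which palindromes of length \<open>k\<close> can arise as a core. The bound
  \<open>e < d\<close> says that every block of the longer word keeps at least one letter of its \<open>q\<close>.
\<close>

definition parents :: "nat \<Rightarrow> nat set" where
  "parents k = {l. \<exists>e<d. d * l + length p = k + 2 * e}"

text \<open>
  Let \<open>n\<close> be the first block whose \<open>q (u n)\<close> meets the given occurrence, and \<open>w\<close> the word of length \<open>l\<close>
  at \<open>n\<close> whose inflation covers the occurrence symmetrically. By alignment the reflection matches the
  first letter of \<open>q (u (n + y))\<close> with the last letter of \<open>q (u (n + l - 1 - y))\<close>, which is also its
  first letter. As this letter determines the argument of \<open>q\<close>, the word \<open>w\<close> is a palindrome.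
\<close>

lemma pals_from_core:
  assumes w: "w \<in> pals u k" and k: "N \<le> k" "3 * d \<le> k"
  shows "\<exists>l e. e < d \<and> d * l + length p = k + 2 * e \<and> w \<in> core e k ` pals u l"
proof -
  obtain i where i: "2 * d \<le> i" and wi: "w = map u [i..<i + k]"
    and symm: "symmetric_window u i k"
    using pals_recurs[OF d_ge_2 w, of "2 * d"] by blast
  obtain T where T: "2 * i + k = r + 2 * c + d * T" using aligned[OF k(1) i symm] by blast
  define n where "n = (i + length p - c) div d"
  define e where "e = (i + length p - c) mod d"
  have e: "e < d" unfolding e_def using d_pos by simp
  have "d * n + e = i + length p - c" unfolding n_def e_def by simp
  then have ne: "d * n + e + c = i + length p" using c_le i length_p by linarith
  have "d * 1 < d * n" using ne i e c_le length_p by linarith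
  then have n: "1 \<le> n" using d_pos by simp
  have start: "d * n + c - length p + e = i"
  proof -
    have "d * 1 \<le> d * n" using n by (intro mult_left_mono) auto
    then show ?thesis using ne length_p by linarith
  qed
  have key: "k + 2 * e + d * (2 * n) = length p + d * (T + 1)"
    using T ne length_p by (simp add: algebra_simps)
  have "d * (2 * n) \<le> d * (T + 1)" using key k(2) length_p by linarith
  then have "2 * n \<le> T + 1" by (rule mult_left_le_imp_le[OF _ d_pos])
  then obtain l where l: "T + 1 = 2 * n + l" using le_iff_add by blast
  have len: "d * l + length p = k + 2 * e" using key unfolding l distrib_left by linarith
  have "d * 2 \<le> d * l" using len k(2) length_p by linarith
  then have l2: "2 \<le> l" by (rule mult_left_le_imp_le[OF _ d_pos])
  \<comment> \<open>The first letter of block \<open>n\<close> itself may be cut off, so \<open>y = 0\<close> is obtained from \<open>y = l - 1\<close> below.\<close>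
  have mirror: "u (n + y) = u (n + l - 1 - y)" if y: "1 \<le> y" "y < l" for y
  proof (rule marked)
    have y1: "d * 1 \<le> d * y" using y by (intro mult_left_mono) auto
    have y2: "d * (y + 1) \<le> d * l" using y by (intro mult_left_mono) auto
    obtain h where h: "n + l = Suc (h + y)" using y by (metis add_Suc_right less_iff_Suc_add
          add.assoc add.commute)
    have hd: "d * n + d * l = d + d * h + d * y" using arg_cong[OF h, of "\<lambda>x. d * x"]
      by (simp add: algebra_simps)
    have "u (d * (n + y) + c) = u (d * h + c + (r - 1))"
    proof (rule symmetric_windowD[OF symm])
      show "d * (n + y) + c + (d * h + c + (r - 1)) + 1 = 2 * i + k"
        using hd ne len length_p r_pos unfolding distrib_left mult_1_right by linarith
      show "i \<le> d * (n + y) + c" using y1 ne e unfolding distrib_left mult_1_right by linarith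
      show "d * (n + y) + c < i + k" using y2 ne e len unfolding distrib_left mult_1_right by linarith
    qed
    then show "hd (q (u (n + y))) = hd (q (u (n + l - 1 - y)))"
      using block_start block_q_end[of h] h by simp
  qed
  have "map u [n..<n + l] \<in> pals u l"
  proof (intro palsI symmetric_windowI)
    fix a b
    assume ab: "a + b + 1 = 2 * n + l" "n \<le> a" "a < n + l"
    show "u a = u b"
    proof (cases "a = n")
      case True
      have "u (n + (l - 1)) = u (n + l - 1 - (l - 1))" by (rule mirror) (use l2 in auto)
      moreover have "b = n + (l - 1)" "n + l - 1 - (l - 1) = n" using True ab l2 by simp_all
      ultimately show ?thesis using True by simp
    next
      case False
      moreover have "n + l - 1 - (a - n) = b" using ab by simp
      ultimately show ?thesis using mirror[of "a - n"] ab by simp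
    qed
  qed
  moreover have "w = core e k (map u [n..<n + l])"
    unfolding core_window[OF n len] start wi ..
  ultimately show ?thesis using e len by blast
qed

lemma parent_bounds:
  assumes "l \<in> parents k" and "d * (M + 1) \<le> k"
  shows "M \<le> l"
proof -
  obtain e where "d * l + length p = k + 2 * e" using assms(1) unfolding parents_def by blast
  then have "d * M \<le> d * l" using assms(2) length_p unfolding distrib_left mult_1_right by linarith
  then show ?thesis using d_pos by simp
qed

text \<open>
  Late occurrences are aligned, and for even \<open>d\<close> the equation of alignment modulo \<open>2\<close> relates \<open>l\<close> to
  \<open>r\<close> alone.
\<close>

lemma long_palindrome_parity:
  assumes "even d" and "N \<le> l" and "pals u l \<noteq> {}"
  shows "even l \<longleftrightarrow> even r"
proof -
  obtain w where "w \<in> pals u l" using assms by blast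
  then obtain i where i: "2 * d \<le> i"
    and symm: "symmetric_window u i l"
    using pals_recurs[OF d_ge_2, of w l "2 * d"] by blast
  obtain T where "2 * i + l = r + 2 * c + d * T" using aligned[OF assms(2) i symm] by blast
  then have "even (2 * i + l) \<longleftrightarrow> even (r + 2 * c + d * T)" by simp
  then show ?thesis using assms(1) by simp
qed

text \<open>
  Two different parents of \<open>k\<close> are \<open>l\<close> and \<open>l + 1\<close> with \<open>d\<close> even, and then one of them has the wrong
  parity to be the length of a palindrome.
\<close>

lemma parents_unique:
  assumes l: "l \<in> parents k" "l' \<in> parents k" and ne: "pals u l \<noteq> {}" "pals u l' \<noteq> {}"
    and k: "d * (N + 1) \<le> k"
  shows "l = l'"
proof -
  have no: False if lt: "l < l'" and l: "l \<in> parents k" "l' \<in> parents k"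
    and ne: "pals u l \<noteq> {}" "pals u l' \<noteq> {}" for l l'
  proof -
    obtain e e' where e: "e < d" "d * l + length p = k + 2 * e"
      and e': "e' < d" "d * l' + length p = k + 2 * e'"
      using l unfolding parents_def by blast
    obtain t where t: "l' = l + t" "0 < t" using lt less_imp_add_positive by blast
    have eq: "d * t + 2 * e = 2 * e'" using e e' unfolding t(1) distrib_left by linarith
    then have "d * t < d * 2" using e' by linarith
    then have "t = 1" using t(2) by simp
    then have ev: "even d" and l': "l' = Suc l" using eq t(1) by presburger+
    have "even l \<longleftrightarrow> even r" "even l' \<longleftrightarrow> even r"
      using long_palindrome_parity[OF ev] ne parent_bounds[OF _ k] l by blast+
    then show False using l' by simp
  qed
  show ?thesis using no[of l l'] no[of l' l] l ne by (metis linorder_neqE_nat)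
qed

lemma finite_parents: "finite (parents k)"
proof (rule finite_subset)
  show "parents k \<subseteq> {..k + 2 * d}"
  proof
    fix l
    assume "l \<in> parents k"
    then have "d * l \<le> k + 2 * d" unfolding parents_def by auto
    moreover have "l \<le> d * l" using d_pos by simp
    ultimately have "l \<le> k + 2 * d" by linarith
    then show "l \<in> {..k + 2 * d}" by simp
  qed
qed simp

lemma pal_complexity_parent:
  assumes l: "l \<in> parents k" and ne: "pals u l \<noteq> {}" and k: "d * (N + 3) \<le> k"
  shows "pal_complexity u k = pal_complexity u l"
proof -
  have k': "N \<le> k" "3 * d \<le> k" "d * (N + 1) \<le> k" "d * (2 + 1) \<le> k"
  proof -
    have "N \<le> d * N" using d_pos by simp
    then show "N \<le> k" "3 * d \<le> k" "d * (N + 1) \<le> k" "d * (2 + 1) \<le> k"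
      using k unfolding distrib_left mult_1_right by linarith+
  qed
  obtain e where e: "d * l + length p = k + 2 * e" "e < d" using l unfolding parents_def by blast
  have l2: "2 \<le> l" by (rule parent_bounds[OF l k'(4)])
  have "core e k ` pals u l = pals u k"
  proof (intro subset_antisym subsetI)
    fix w
    assume w: "w \<in> pals u k"
    obtain l' e' where l': "e' < d" "d * l' + length p = k + 2 * e'" "w \<in> core e' k ` pals u l'"
      using pals_from_core[OF w k'(1,2)] by blast
    then have "l' = l"
      using parents_unique[OF _ l _ ne k'(3), of l'] unfolding parents_def by blast
    then show "w \<in> core e k ` pals u l" using l' e by simp
  qed (use core_pals[OF _ e(1)] l2 in auto)
  then show ?thesis
    unfolding pal_complexity_card using card_image[OF inj_on_core[OF e l2]] by simp
qed

lemma pal_complexity_no_parent: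
  assumes none: "\<And>l. l \<in> parents k \<Longrightarrow> pals u l = {}" and k: "d * (N + 3) \<le> k"
  shows "pal_complexity u k = 0"
proof -
  have "N \<le> d * N" using d_pos by simp
  then have "N \<le> k" "3 * d \<le> k" using k unfolding distrib_left mult_1_right by linarith+
  then have "pals u k = {}" using pals_from_core none unfolding parents_def by blast
  then show ?thesis by (simp add: pal_complexity_card)
qed

text \<open>
  At most one summand is nonzero. Writing the recurrence as a sum makes its form independent of which
  one it is.
\<close>

lemma pal_complexity_sum_parents:
  assumes k: "d * (N + 3) \<le> k"
  shows "pal_complexity u k = (\<Sum>l\<in>parents k. pal_complexity u l)"
proof (cases "\<exists>l\<in>parents k. pals u l \<noteq> {}")
  case True
  then obtain l where l: "l \<in> parents k" "pals u l \<noteq> {}" by blast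
  have "d * (N + 1) \<le> k" using k unfolding distrib_left mult_1_right by linarith
  then have "pals u l' = {}" if "l' \<in> parents k - {l}" for l'
    using parents_unique[of l' k l] that l by blast
  then have "pal_complexity u l' = 0" if "l' \<in> parents k - {l}" for l'
    using that by (simp add: pal_complexity_card)
  then have "(\<Sum>l\<in>parents k. pal_complexity u l) = (\<Sum>l\<in>{l}. pal_complexity u l)"
    using l(1) finite_parents by (intro sum.mono_neutral_right) auto
  then show ?thesis using pal_complexity_parent[OF l k] by simp
next
  case False
  then have "(\<Sum>l\<in>parents k. pal_complexity u l) = 0" by (simp add: pal_complexity_card)
  then show ?thesis using pal_complexity_no_parent[OF _ k] False by simp
qed

text \<open>
  Every value at a large \<open>k\<close> is either \<open>0\<close> or equal to the value at a smaller argument, so no value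
  exceeds all the initial ones.
\<close>

lemma pal_complexity_bounded: "\<exists>C. \<forall>k. pal_complexity u k \<le> C"
proof -
  define M where "M = d * (N + 3)"
  define C where "C = (\<Sum>k<M. pal_complexity u k)"
  have "pal_complexity u k \<le> C" for k
  proof (induction k rule: less_induct)
    case (less k)
    show ?case
    proof (cases "k < M")
      case True
      then show ?thesis unfolding C_def by (intro member_le_sum) auto
    next
      case False
      then have k: "d * (N + 3) \<le> k" unfolding M_def by simp
      show ?thesis
      proof (cases "\<exists>l\<in>parents k. pals u l \<noteq> {}")
        case True
        then obtain l where l: "l \<in> parents k" "pals u l \<noteq> {}" by blast
        have "l < k"
        proof (rule ccontr)
          assume "\<not> l < k"
          then have "d * k \<le> d * l" by (intro mult_left_mono) auto
          moreover have "2 * k \<le> d * k" using d_ge_2 by simp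
          moreover have "d * l < k + 2 * d" using l(1) unfolding parents_def by auto
          moreover have "2 * d \<le> k" using k unfolding distrib_left mult_1_right by linarith
          ultimately show False by linarith
        qed
        then show ?thesis using pal_complexity_parent[OF l k] less by simp
      next
        case False
        then show ?thesis using pal_complexity_no_parent[OF _ k] by simp
      qed
    qed
  qed
  then show ?thesis by blast
qed

text \<open>
  This makes the recurrence at \<open>d * n + j\<close> the same for all \<open>n\<close>, as a morphism requires.
\<close>

lemma parents_shift: "parents (d * n + j) = (+) n ` parents j"
proof (intro subset_antisym subsetI)
  fix l
  assume "l \<in> parents (d * n + j)"
  then obtain e where e: "e < d" "d * l + length p = d * n + j + 2 * e"
    unfolding parents_def by blast
  have "d * n < d * (l + 1)" using e length_p r_pos unfolding distrib_left mult_1_right by linarith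
  then have "n < l + 1" by (rule mult_left_less_imp_less) simp
  then obtain i where i: "l = n + i" using le_iff_add[of n l] by auto
  have "d * i + length p = j + 2 * e" using e(2) unfolding i distrib_left by linarith
  then show "l \<in> (+) n ` parents j" using e(1) i unfolding parents_def by blast
qed (auto simp: parents_def distrib_left)

lemma parents_small:
  assumes "i \<in> parents j" and "j \<le> d + 1"
  shows "i \<le> 2"
proof -
  obtain e where "e < d" "d * i + length p = j + 2 * e"
    using assms(1) unfolding parents_def by blast
  then have "d * i < d * 3" using assms(2) by linarith
  then show ?thesis by simp
qed

lemma automatic_pal_complexity: "automatic d (\<lambda>n. pal_complexity u (Suc n))"
proof -
  obtain C where C: "\<And>k. pal_complexity u k \<le> C" using pal_complexity_bounded by blast
  have rec: "pal_complexity u (d * n + j) = (\<Sum>i\<in>parents j. pal_complexity u (n + i))"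
    if "N + 3 \<le> n" for n j
  proof -
    have "d * (N + 3) \<le> d * n" using that by (rule mult_left_mono) simp
    then have "d * (N + 3) \<le> d * n + j" by (rule trans_le_add1)
    then have "pal_complexity u (d * n + j) = (\<Sum>l\<in>(+) n ` parents j. pal_complexity u l)"
      unfolding parents_shift[symmetric] by (rule pal_complexity_sum_parents)
    then show ?thesis by (simp add: sum.reindex)
  qed
  show ?thesis
  proof (rule automatic_of_window_recurrence[OF d_pos C])
    fix n n' j
    assume "N + 3 \<le> n" "N + 3 \<le> n'" "j \<le> d + 1"
      and "\<And>i. i \<le> 2 \<Longrightarrow> pal_complexity u (n + i) = pal_complexity u (n' + i)"
    then show "pal_complexity u (d * n + j) = pal_complexity u (d * n' + j)"
      using rec parents_small by (auto intro!: sum.cong)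
  qed
qed

end

theorem theorem10:
  fixes A :: "'a set" and \<sigma> q :: "'a \<Rightarrow> 'a list" and p :: "'a list"
    and u :: "nat \<Rightarrow> 'a" and d :: nat
  assumes "finite A"
    and "morphism_on A \<sigma>" and "primitive_on A \<sigma>"
    and "range u \<subseteq> A" and "fixed_point \<sigma> u"
    and class_P: "class_P_by A \<sigma> p q"
    and uniform: "uniform_on A d \<sigma>"
    and distinct_first: "\<And>a b. a \<in> A \<Longrightarrow> b \<in> A \<Longrightarrow> a \<noteq> b \<Longrightarrow>
      q a \<noteq> [] \<and> q b \<noteq> [] \<and> hd (q a) \<noteq> hd (q b)"
  shows "automatic d (\<lambda>n. pal_complexity u (Suc n))"
proof -
  have inA: "u n \<in> A" for n using assms(4) by blast
  have len: "length (\<sigma> (u n)) = d" for n using uniform inA unfolding uniform_on_def by blast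
  have pal_q: "palindrome (q (u n))" for n using class_P inA unfolding class_P_by_def by blast
  have length_q: "length p + length (q (u n)) = d" for n
    using class_P inA[of n] len[of n] unfolding class_P_by_def by auto
  have d: "0 < d" using class_P inA[of 0] length_q[of 0] unfolding class_P_by_def by auto
  obtain K where "uniform_recurrent u d K"
    using uniform_recurrent_fixed_point[OF assms(3-5) uniform d] by blast
  then interpret uniform_recurrent u d K .
  show ?thesis
  proof (cases "\<forall>n n'. u n = u n' \<longrightarrow> u (n + 1) = u (n' + 1)")
    case True
    have "finite (range u)" using assms(1,4) by (rule rev_finite_subset)
    then obtain P where P: "0 < P" "\<And>n. u (n + P) = u n"
      using periodic_of_deterministic True by blast
    show ?thesis
    proof (rule automatic_of_eventually_periodic[OF d P(1)])
      fix n
      assume "P \<le> n"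
      then show "pal_complexity u (Suc (n + P)) = pal_complexity u (Suc n)"
        using pal_complexity_periodic[of u P "Suc n"] P(2) by simp
    qed
  next
    case False
    then obtain y z where yz: "u y = u z" "u (y + 1) \<noteq> u (z + 1)" by blast
    \<comment> \<open>One of \<open>u (y + 1)\<close> and \<open>u (z + 1)\<close> differs from \<open>u n\<close>.\<close>
    have q_nonempty: "q (u n) \<noteq> []" for n
      using distinct_first[OF inA[of n] inA[of "y + 1"]] distinct_first[OF inA[of n] inA[of "z + 1"]] yz(2)
      by metis
    \<comment> \<open>A primitive morphism that maps letters to letters lives on a single letter.\<close>
    have "d \<noteq> 1"
    proof
      assume d1: "d = 1"
      obtain k where k: "\<forall>a\<in>A. \<forall>b\<in>A. b \<in> set ((apply_word \<sigma> ^^ k) [a])"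
        using assms(3) unfolding primitive_on_def by blast
      have "u (z + 1) \<in> set ((apply_word \<sigma> ^^ k) [u (y + 1)])" using k inA by blast
      then show False using fixed_point_power[OF assms(5) len] yz(2) d1 by simp
    qed
    then have d2: "2 \<le> d" using d by simp
    have nth: "u (d * n + x) = \<sigma> (u n) ! x" if "x < d" for n x
      by (rule fixed_point_nth[OF assms(5) len that])
    \<comment> \<open>The witness is \<open>c = 0\<close> or \<open>c = length p\<close>, according to the side on which \<open>p\<close> stands.\<close>
    have "\<exists>c\<le>length p. \<forall>n x. x < d \<longrightarrow> u (d * n + c + x) = (q (u n) @ p) ! x"
    proof (cases "\<forall>a\<in>A. \<sigma> a = q a @ p")
      case True
      then show ?thesis using nth inA by (intro exI[of _ 0]) simp
    next
      case False
      then have \<sigma>: "\<sigma> (u n) = p @ q (u n)" for n using class_P inA unfolding class_P_by_def by blast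
      have "u (d * n + length p + x) = (q (u n) @ p) ! x" if x: "x < d" for n x
      proof (cases "x < length (q (u n))")
        case True
        then show ?thesis using nth[of "length p + x" n] length_q[of n] \<sigma>
          by (simp add: nth_append add.assoc)
      next
        case False
        define t where "t = x - length (q (u n))"
        have t: "x = length (q (u n)) + t" "t < length p" "t < d"
          using False x length_q[of n] unfolding t_def by linarith+
        have "d * n + length p + x = d * (n + 1) + t"
          using t(1) length_q[of n] unfolding distrib_left mult_1_right by linarith
        then have "u (d * n + length p + x) = \<sigma> (u (n + 1)) ! t" by (simp only: nth[OF t(3)])
        then show ?thesis using \<sigma> t by (simp add: nth_append)
      qed
      then show ?thesis by blast
    qed
    then obtain c where c: "c \<le> length p"
      and block: "\<And>n x. x < d \<Longrightarrow> u (d * n + c + x) = (q (u n) @ p) ! x" by blast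
    interpret marked_class_P u d K p q c
    proof
      show "palindrome p" using class_P unfolding class_P_by_def by blast
      show "u x = u y" if "hd (q (u x)) = hd (q (u y))" for x y
        using distinct_first[OF inA inA] that by blast
    qed (use d2 pal_q length_q q_nonempty block c in auto)
    obtain N where N: "\<And>i k. N \<le> k \<Longrightarrow> 2 * d \<le> i \<Longrightarrow>
        symmetric_window u i k \<Longrightarrow> \<exists>T. 2 * i + k = r + 2 * c + d * T"
      using long_palindromes_aligned[OF yz] by blast
    interpret recognizable_class_P u d K p q c N
      by unfold_locales (rule N)
    show ?thesis by (rule automatic_pal_complexity)
  qed
qed

end
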